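(* Let $\mathrm{a}_{n,k}^{\mathrm{dasc}}(213,312)$ (respectively $\mathrm{a}_{n,k}^{\mathrm{ddes}}(213,312)$) denote the number of permutations of $\{1,\dots,n\}$ that avoid both $213$ and $312$ and have exactly $k$ double ascents (respectively $k$ double descents). Then for all integers $n\ge 1$ and $k\ge 0$, $$\mathrm{a}_{n,k}^{\mathrm{dasc}}(213,312)=\mathrm{a}_{n,k}^{\mathrm{ddes}}(213,312)=\begin{cases} n, & k=0;\\ \binom{n-1}{k+1}, & k\ge 1.\end{cases}$$
   Context: $\mathcal{S}_n$ is the set of permutations $\pi=\pi_1\cdots\pi_n$ of $\{1,\dots,n\}$. For $\rho\in\mathcal{S}_m$, $\pi\in\mathcal{S}_n$ contains $\rho$ if there are indices $1\le i_1<\cdots<i_m\le n$ such that $\pi_{i_a}<\pi_{i_b}$ if and only if $\rho_a<\rho_b$; otherwise $\pi$ avoids $\rho$. The number of double ascents is $\mathrm{dasc}(\pi)=|\{i:\pi_i<\pi_{i+1}<\pi_{i+2}\}|$ and the number of double descents is $\mathrm{ddes}(\pi)=|\{i:\pi_i>\pi_{i+1}>\pi_{i+2}\}|$, where $1\le i\le n-2$. Binomial coefficients $\binom{m}{j}$ with $j>m\ge 0$ are $0$. *)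

theory Defs
  imports "HOL-Combinatorics.Multiset_Permutations"
begin

text \<open>
  Permutations are in one-line notation: \<open>\<pi>\<^sub>1 \<dots> \<pi>\<^sub>n\<close> is a list with entries in \<open>{1..n}\<close>.
  List positions start at 0, so \<open>\<pi>\<^sub>i\<close> is \<open>\<pi> ! (i - 1)\<close>.
\<close>

abbreviation Sym :: "nat \<Rightarrow> nat list set" where
  "Sym n \<equiv> permutations_of_set {1..n}"

definition contains_pattern :: "nat list \<Rightarrow> nat list \<Rightarrow> bool" where
  "contains_pattern \<pi> \<rho> \<longleftrightarrow>
     (\<exists>f :: nat \<Rightarrow> nat.
        strict_mono_on {..<length \<rho>} f \<and> f ` {..<length \<rho>} \<subseteq> {..<length \<pi>} \<and>
        (\<forall>a<length \<rho>. \<forall>b<length \<rho>. \<pi> ! f a < \<pi> ! f b \<longleftrightarrow> \<rho> ! a < \<rho> ! b))"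

definition avoids :: "nat list \<Rightarrow> nat list \<Rightarrow> bool" where
  "avoids \<pi> \<rho> \<longleftrightarrow> \<not> contains_pattern \<pi> \<rho>"

definition dasc :: "nat list \<Rightarrow> nat" where
  "dasc \<pi> = card {i. i + 2 < length \<pi> \<and> \<pi> ! i < \<pi> ! (i + 1) \<and> \<pi> ! (i + 1) < \<pi> ! (i + 2)}"

definition ddes :: "nat list \<Rightarrow> nat" where
  "ddes \<pi> = card {i. i + 2 < length \<pi> \<and> \<pi> ! i > \<pi> ! (i + 1) \<and> \<pi> ! (i + 1) > \<pi> ! (i + 2)}"

definition avoid_count :: "(nat list \<Rightarrow> nat) \<Rightarrow> nat list set \<Rightarrow> nat \<Rightarrow> nat \<Rightarrow> nat" where
  "avoid_count st P n k = card {\<pi> \<in> Sym n. (\<forall>\<rho>\<in>P. avoids \<pi> \<rho>) \<and> st \<pi> = k}"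

end

theory Submission
  imports Defs
begin

text \<open>
  Avoiding 213 and 312 means having no valley, so the permutation increases up to its maximum \<open>n\<close>
  and decreases afterwards. It is therefore determined by the set \<open>A \<subseteq> {1..<n}\<close> of entries to the
  left of \<open>n\<close>, and it has \<open>card A - 1\<close> double ascents and \<open>card ({1..<n} - A) - 1\<close> double descents
  (truncated subtraction). So \<open>k = 0\<close> is attained by the sets of size 0 and 1, and \<open>k \<ge> 1\<close> by
  those of size \<open>k + 1\<close>.
\<close>

text \<open>The embedding \<open>f\<close> is traded for the three positions
  \<open>f 0 < f 1 < f 2\<close>. Both directions of each comparison are kept because nothing here
  excludes repeated entries.\<close>

lemma contains_pattern_3_iff:
  "contains_pattern p [a, b, c] \<longleftrightarrow>
     (\<exists>i j k. i < j \<and> j < k \<and> k < length p \<and>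
        (p ! i < p ! j \<longleftrightarrow> a < b) \<and> (p ! i < p ! k \<longleftrightarrow> a < c) \<and> (p ! j < p ! k \<longleftrightarrow> b < c) \<and>
        (p ! j < p ! i \<longleftrightarrow> b < a) \<and> (p ! k < p ! i \<longleftrightarrow> c < a) \<and> (p ! k < p ! j \<longleftrightarrow> c < b))"
    (is "?L \<longleftrightarrow> ?R")
proof
  have lt3: "{..<length [a, b, c]} = {0, 1, 2}" by auto
  show ?R if ?L
  proof -
    from that obtain f where f: "strict_mono_on {0, 1, 2} f" "f ` {0, 1, 2} \<subseteq> {..<length p}"
      "\<And>x y. x < 3 \<Longrightarrow> y < 3 \<Longrightarrow> p ! f x < p ! f y \<longleftrightarrow> [a, b, c] ! x < [a, b, c] ! y"
      unfolding contains_pattern_def lt3 by (auto simp: numeral_3_eq_3)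
    have "f 0 < f 1" "f 1 < f 2"
      using f(1) by (auto simp: strict_mono_on_def)
    moreover have "f 2 < length p" using f(2) by auto
    ultimately show ?R
      using f(3)[of 0 1] f(3)[of 0 2] f(3)[of 1 2] f(3)[of 1 0] f(3)[of 2 0] f(3)[of 2 1]
      by (intro exI[of _ "f 0"] exI[of _ "f 1"] exI[of _ "f 2"]) simp
  qed
  show ?L if ?R
  proof -
    from that obtain i j k where "i < j" "j < k" "k < length p"
      "p ! i < p ! j \<longleftrightarrow> a < b" "p ! i < p ! k \<longleftrightarrow> a < c" "p ! j < p ! k \<longleftrightarrow> b < c"
      "p ! j < p ! i \<longleftrightarrow> b < a" "p ! k < p ! i \<longleftrightarrow> c < a" "p ! k < p ! j \<longleftrightarrow> c < b"
      by blast
    note ijk = this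
    have "strict_mono_on {0, 1, 2} ((!) [i, j, k])"
      using ijk(1,2) by (auto simp: strict_mono_on_def)
    moreover have "(!) [i, j, k] ` {0, 1, 2} \<subseteq> {..<length p}"
      using ijk(1-3) by auto
    moreover have "\<forall>x<length [a, b, c]. \<forall>y<length [a, b, c].
        p ! ([i, j, k] ! x) < p ! ([i, j, k] ! y) \<longleftrightarrow> [a, b, c] ! x < [a, b, c] ! y"
      using ijk(4-) by (simp add: All_less_Suc)
    ultimately show ?L
      unfolding contains_pattern_def lt3 by (intro exI[of _ "(!) [i, j, k]"] conjI)
  qed
qed

text \<open>Both patterns have their smallest entry in the middle and differ only in which outer
  entry is larger. Distinct outer entries are always comparable, so containing one of the two
  patterns amounts to having a valley.\<close>

lemma avoids_213_312_iff:
  assumes "distinct p"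
  shows "avoids p [2, 1, 3] \<and> avoids p [3, 1, 2] \<longleftrightarrow>
    (\<forall>i j k. i < j \<longrightarrow> j < k \<longrightarrow> k < length p \<longrightarrow> p ! i < p ! j \<or> p ! k < p ! j)"
proof -
  have neq: "p ! i \<noteq> p ! j" if "i < j" "j < length p" for i j
    using that assms by (simp add: nth_eq_iff_index_eq)
  have "contains_pattern p [2, 1, 3] \<or> contains_pattern p [3, 1, 2] \<longleftrightarrow>
      (\<exists>i j k. i < j \<and> j < k \<and> k < length p \<and> p ! j < p ! i \<and> p ! j < p ! k)"
    unfolding contains_pattern_3_iff ex_disj_distrib[symmetric]
  proof (intro ex_cong1)
    fix i j k
    \<comment> \<open>The third case covers index triples for which \<open>neq\<close> says nothing;
      there both sides are false.\<close>
    consider "p ! i < p ! k" | "p ! k < p ! i" | "\<not> (i < j \<and> j < k \<and> k < length p)"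
      using neq[of i k] by (meson less_trans nat_neq_iff)
    then show "(i < j \<and> j < k \<and> k < length p \<and>
        (p ! i < p ! j \<longleftrightarrow> 2 < (1::nat)) \<and> (p ! i < p ! k \<longleftrightarrow> 2 < (3::nat)) \<and>
        (p ! j < p ! k \<longleftrightarrow> 1 < (3::nat)) \<and> (p ! j < p ! i \<longleftrightarrow> 1 < (2::nat)) \<and>
        (p ! k < p ! i \<longleftrightarrow> 3 < (2::nat)) \<and> (p ! k < p ! j \<longleftrightarrow> 3 < (1::nat)) \<or>
        i < j \<and> j < k \<and> k < length p \<and>
        (p ! i < p ! j \<longleftrightarrow> 3 < (1::nat)) \<and> (p ! i < p ! k \<longleftrightarrow> 3 < (2::nat)) \<and>
        (p ! j < p ! k \<longleftrightarrow> 1 < (2::nat)) \<and> (p ! j < p ! i \<longleftrightarrow> 1 < (3::nat)) \<and>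
        (p ! k < p ! i \<longleftrightarrow> 2 < (3::nat)) \<and> (p ! k < p ! j \<longleftrightarrow> 2 < (1::nat))) \<longleftrightarrow>
        i < j \<and> j < k \<and> k < length p \<and> p ! j < p ! i \<and> p ! j < p ! k"
      by cases auto
  qed
  moreover have "(p ! i < p ! j \<or> p ! k < p ! j) \<longleftrightarrow> \<not> (p ! j < p ! i \<and> p ! j < p ! k)"
    if "i < j" "j < k" "k < length p" for i j k
    using that neq[of i j] neq[of j k] by auto
  ultimately show ?thesis unfolding avoids_def by blast
qed

text \<open>The peak \<open>m\<close> belongs to both monotone runs, so position
  \<open>length xs\<close> is allowed as the right end of an ascent and as the left end of a
  descent.\<close>

lemma
  assumes "sorted_wrt (<) (xs @ [m])" "sorted_wrt (>) (m # ys)"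
  shows unimodal_nth_less:
      "i < j \<Longrightarrow> j \<le> length xs \<Longrightarrow> (xs @ m # ys) ! i < (xs @ m # ys) ! j"
    and unimodal_nth_greater:
      "length xs \<le> i \<Longrightarrow> i < j \<Longrightarrow> j < length (xs @ m # ys) \<Longrightarrow> (xs @ m # ys) ! j < (xs @ m # ys) ! i"
proof -
  assume "i < j" "j \<le> length xs"
  then show "(xs @ m # ys) ! i < (xs @ m # ys) ! j"
    using sorted_wrt_nth_less[OF assms(1), of i j]
    by (auto simp: nth_append nth_Cons split: nat.splits if_splits)
next
  assume "length xs \<le> i" "i < j" "j < length (xs @ m # ys)"
  then show "(xs @ m # ys) ! j < (xs @ m # ys) ! i"
    using sorted_wrt_nth_less[OF assms(2), of "i - length xs" "j - length xs"]
    by (auto simp: nth_append)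
qed

lemma dasc_unimodal:
  assumes "sorted_wrt (<) (xs @ [m])" "sorted_wrt (>) (m # ys)"
  shows "dasc (xs @ m # ys) = length xs - 1"
proof -
  let ?p = "xs @ m # ys"
  note less = unimodal_nth_less[OF assms] and greater = unimodal_nth_greater[OF assms]
  have "i < length xs - 1 \<longleftrightarrow> i + 2 < length ?p \<and> ?p ! i < ?p ! (i + 1) \<and> ?p ! (i + 1) < ?p ! (i + 2)"
    for i
    \<comment> \<open>If \<open>i + 2 \<le> length xs\<close>, all three positions lie on the
      ascending run including the peak. Otherwise \<open>i + 1\<close> is at or past the peak, so
      any step to \<open>i + 2\<close> descends.\<close>
    using less[of i "i + 1"] less[of "i + 1" "i + 2"] greater[of "i + 1" "i + 2"]
    by (cases "i + 2 \<le> length xs") auto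
  then have "{i. i + 2 < length ?p \<and> ?p ! i < ?p ! (i + 1) \<and> ?p ! (i + 1) < ?p ! (i + 2)} =
      {..<length xs - 1}" by blast
  then show ?thesis unfolding dasc_def by simp
qed

lemma ddes_unimodal:
  assumes "sorted_wrt (<) (xs @ [m])" "sorted_wrt (>) (m # ys)"
  shows "ddes (xs @ m # ys) = length ys - 1"
proof -
  let ?p = "xs @ m # ys"
  note less = unimodal_nth_less[OF assms] and greater = unimodal_nth_greater[OF assms]
  have "length xs \<le> i \<and> i < length xs + (length ys - 1) \<longleftrightarrow>
      i + 2 < length ?p \<and> ?p ! i > ?p ! (i + 1) \<and> ?p ! (i + 1) > ?p ! (i + 2)" for i
    \<comment> \<open>From the peak onwards both steps descend; for \<open>i < length xs\<close> the
      step from \<open>i\<close> to \<open>i + 1\<close> still ascends.\<close>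
    using less[of i "i + 1"] greater[of i "i + 1"] greater[of "i + 1" "i + 2"]
    by (cases "length xs \<le> i") auto
  then have "{i. i + 2 < length ?p \<and> ?p ! i > ?p ! (i + 1) \<and> ?p ! (i + 1) > ?p ! (i + 2)} =
      {length xs..<length xs + (length ys - 1)}"
    by (intro set_eqI) (simp only: mem_Collect_eq atLeastLessThan_iff)
  then show ?thesis unfolding ddes_def by simp
qed

text \<open>Inverse to the map that sends a valley-free permutation to the set of entries before its
  maximum. Both sides of \<open>n\<close> have a forced order, so a set carries all the
  data.\<close>

definition unimodal_perm :: "nat \<Rightarrow> nat set \<Rightarrow> nat list" where
  "unimodal_perm n A = sorted_list_of_set A @ n # rev (sorted_list_of_set ({1..<n} - A))"

context
  fixes n :: nat and A :: "nat set"
  assumes A: "A \<subseteq> {1..<n}"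
begin

lemma unimodal_perm_sorted:
  shows "sorted_wrt (<) (sorted_list_of_set A @ [n])"
    and "sorted_wrt (>) (n # rev (sorted_list_of_set ({1..<n} - A)))"
  using A finite_subset[OF A] by (auto simp: sorted_wrt_append sorted_wrt_rev)

lemma unimodal_perm_in_Sym:
  assumes "n \<ge> 1"
  shows "unimodal_perm n A \<in> Sym n"
  using assms A finite_subset[OF A]
  by (intro permutations_of_setI) (auto simp: unimodal_perm_def)

text \<open>If \<open>j\<close> is at or before the peak, the entry at \<open>i\<close> is smaller;
  if it is at or after the peak, the entry at \<open>k\<close> is.\<close>

lemma unimodal_perm_no_valley:
  assumes "i < j" "j < k" "k < length (unimodal_perm n A)"
  shows "unimodal_perm n A ! i < unimodal_perm n A ! j \<or> unimodal_perm n A ! k < unimodal_perm n A ! j"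
  using assms unimodal_nth_less[OF unimodal_perm_sorted] unimodal_nth_greater[OF unimodal_perm_sorted]
  unfolding unimodal_perm_def by (meson nat_le_linear)

lemma dasc_unimodal_perm: "dasc (unimodal_perm n A) = card A - 1"
  unfolding unimodal_perm_def dasc_unimodal[OF unimodal_perm_sorted] by simp

lemma ddes_unimodal_perm: "ddes (unimodal_perm n A) = card ({1..<n} - A) - 1"
  unfolding unimodal_perm_def ddes_unimodal[OF unimodal_perm_sorted] by simp

text \<open>Since \<open>n\<close> is not in \<open>A\<close>, cutting at \<open>n\<close> recovers
  \<open>A\<close>; this left inverse yields injectivity.\<close>

lemma set_takeWhile_unimodal_perm: "set (takeWhile (\<lambda>x. x \<noteq> n) (unimodal_perm n A)) = A"
proof -
  have "\<forall>x\<in>set (sorted_list_of_set A). x \<noteq> n"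
    using A finite_subset[OF A] by auto
  moreover have "finite A" using A finite_subset by blast
  ultimately show ?thesis
    unfolding unimodal_perm_def by (subst takeWhile_append2) auto
qed

end

lemma inj_on_unimodal_perm: "inj_on (unimodal_perm n) (Pow {1..<n})"
  by (rule inj_on_inverseI[where g = "\<lambda>p. set (takeWhile (\<lambda>x. x \<noteq> n) p)"])
    (simp add: set_takeWhile_unimodal_perm)

lemma no_valley_imp_unimodal_perm:
  assumes "n \<ge> 1" "p \<in> Sym n"
    and valley: "\<And>i j k. i < j \<Longrightarrow> j < k \<Longrightarrow> k < length p \<Longrightarrow> p ! i < p ! j \<or> p ! k < p ! j"
  shows "\<exists>A\<subseteq>{1..<n}. p = unimodal_perm n A"
proof -
  have p: "set p = {1..n}" "distinct p"
    using assms(2) by (auto simp: permutations_of_set_def)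
  then have "n \<in> set p" using assms(1) by simp
  then obtain xs ys where split: "p = xs @ n # ys" by (meson split_list)
  have sets: "set xs \<subseteq> {1..<n}" "set ys = {1..<n} - set xs"
    using p unfolding split by force+
  have "sorted_wrt (<) xs"
    unfolding sorted_wrt_iff_nth_less
  proof (intro allI impI)
    fix i j assume ij: "i < j" "j < length xs"
    then have "xs ! j < n" using sets(1) nth_mem by fastforce
    then show "xs ! i < xs ! j"
      \<comment> \<open>The maximum \<open>n\<close> serves as the right end of the triple, so its
        alternative \<open>n < xs ! j\<close> fails.\<close>
      using valley[of i j "length xs"] ij by (auto simp: split nth_append)
  qed
  moreover have "sorted_wrt (>) ys"
    unfolding sorted_wrt_iff_nth_less
  proof (intro allI impI)
    fix i j assume ij: "i < j" "j < length ys"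
    then have "ys ! i < n" using sets(2) nth_mem[of i ys] by force
    then show "ys ! i > ys ! j"
      \<comment> \<open>Now \<open>n\<close> is the left end, and \<open>ys ! i\<close> sits in the
        middle.\<close>
      using valley[of "length xs" "length xs + Suc i" "length xs + Suc j"] ij
      by (auto simp: split nth_append)
  qed
  then have "sorted_wrt (<) (rev ys)" by (simp add: sorted_wrt_rev)
  ultimately have "xs = sorted_list_of_set (set xs)" "rev ys = sorted_list_of_set (set (rev ys))"
    unfolding strict_sorted_iff by (metis sorted_list_of_set.idem_if_sorted_distinct)+
  then have "p = unimodal_perm n (set xs)"
    by (metis split unimodal_perm_def rev_rev_ident set_rev sets(2))
  then show ?thesis using sets(1) by blast
qed

text \<open>The bijection with subsets does not depend on the statistic, so \<open>st\<close> stays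
  arbitrary and one lemma serves both counts.\<close>

lemma avoid_count_213_312:
  assumes "n \<ge> 1"
  shows "avoid_count st {[2, 1, 3], [3, 1, 2]} n k = card {A. A \<subseteq> {1..<n} \<and> st (unimodal_perm n A) = k}"
proof -
  have avoid: "(\<forall>\<rho>\<in>{[2, 1, 3], [3, 1, 2]}. avoids p \<rho>) \<longleftrightarrow> (\<exists>A\<subseteq>{1..<n}. p = unimodal_perm n A)"
    if "p \<in> Sym n" for p
  proof -
    have "distinct p" using that by (simp add: permutations_of_set_def)
    then have "(\<forall>\<rho>\<in>{[2, 1, 3], [3, 1, 2]}. avoids p \<rho>) \<longleftrightarrow>
        (\<forall>i j k. i < j \<longrightarrow> j < k \<longrightarrow> k < length p \<longrightarrow> p ! i < p ! j \<or> p ! k < p ! j)"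
      using avoids_213_312_iff[of p] by simp
    also have "\<dots> \<longleftrightarrow> (\<exists>A\<subseteq>{1..<n}. p = unimodal_perm n A)"
      using no_valley_imp_unimodal_perm[OF assms that] unimodal_perm_no_valley by blast
    finally show ?thesis .
  qed
  have "{p \<in> Sym n. (\<forall>\<rho>\<in>{[2, 1, 3], [3, 1, 2]}. avoids p \<rho>) \<and> st p = k} =
      {p \<in> Sym n. (\<exists>A\<subseteq>{1..<n}. p = unimodal_perm n A) \<and> st p = k}"
    using avoid by blast
  also have "\<dots> = unimodal_perm n ` {A. A \<subseteq> {1..<n} \<and> st (unimodal_perm n A) = k}"
    using unimodal_perm_in_Sym assms by auto
  finally show ?thesis
    unfolding avoid_count_def
    by (simp add: card_image inj_on_subset[OF inj_on_unimodal_perm] Collect_mono Pow_def)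
qed

text \<open>Truncated subtraction sends both sizes 0 and 1 to \<open>k = 0\<close>, which gives the
  exceptional value; for positive \<open>k\<close> only size \<open>k + 1\<close> remains.\<close>

lemma card_subsets_pred:
  assumes "finite S"
  shows "card {A. A \<subseteq> S \<and> card A - 1 = k} = (if k = 0 then card S + 1 else card S choose (k + 1))"
proof (cases "k = 0")
  case True
  have "{A. A \<subseteq> S \<and> card A - 1 = k} = {A. A \<subseteq> S \<and> card A = 0} \<union> {A. A \<subseteq> S \<and> card A = 1}"
    using True by auto
  moreover have "card \<dots> = card {A. A \<subseteq> S \<and> card A = 0} + card {A. A \<subseteq> S \<and> card A = 1}"
    using assms by (intro card_Un_disjoint) auto
  ultimately show ?thesis
    using True n_subsets[OF assms, of 0] n_subsets[OF assms, of 1] by simp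
next
  case False
  then have "card A - 1 = k \<longleftrightarrow> card A = k + 1" for A :: "'a set" by auto
  then show ?thesis using False n_subsets[OF assms, of "k + 1"] by simp
qed

text \<open>Complementation in \<open>S\<close> is an involution on its subsets. This exchanges the
  entries left and right of the maximum, hence reduces double descents to the count for double
  ascents.\<close>

lemma card_subsets_complement:
  "card {A. A \<subseteq> S \<and> P (S - A)} = card {A. A \<subseteq> S \<and> P A}"
  by (rule bij_betw_same_card[of "\<lambda>A. S - A"], rule bij_betw_byWitness[where f' = "\<lambda>A. S - A"])
    (auto simp: double_diff)

theorem proposition7:
  fixes n k :: nat
  assumes "n \<ge> 1"
  shows "avoid_count dasc {[2, 1, 3], [3, 1, 2]} n k = avoid_count ddes {[2, 1, 3], [3, 1, 2]} n k
       \<and> avoid_count ddes {[2, 1, 3], [3, 1, 2]} n k = (if k = 0 then n else (n - 1) choose (k + 1))"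
proof -
  let ?c = "card {A. A \<subseteq> {1..<n} \<and> card A - 1 = k}"
  have "avoid_count dasc {[2, 1, 3], [3, 1, 2]} n k = ?c"
    unfolding avoid_count_213_312[OF assms]
    \<comment> \<open>\<open>conj_cong\<close> makes \<open>A \<subseteq> {1..<n}\<close> available
      when the statistic is rewritten.\<close>
    by (simp add: dasc_unimodal_perm cong: conj_cong)
  moreover have "avoid_count ddes {[2, 1, 3], [3, 1, 2]} n k = ?c"
    unfolding avoid_count_213_312[OF assms] card_subsets_complement[of _ "\<lambda>A. card A - 1 = k", symmetric]
    by (simp add: ddes_unimodal_perm cong: conj_cong)
  \<comment> \<open>Here \<open>{1..<n}\<close> has \<open>n - 1\<close> elements, and
    \<open>n \<ge> 1\<close> turns \<open>n - 1 + 1\<close> into \<open>n\<close> for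
    \<open>k = 0\<close>.\<close>
  ultimately show ?thesis
    using assms card_subsets_pred[of "{1..<n}" k] by simp
qed

end
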